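(* Let $q$ be a prime power, let $n,t,s,\ell$ be positive integers with $\gcd(s,n)=1$ and $1\le\ell\le t-1$, and let $\sigma\colon x\mapsto x^{q^s}$, an automorphism of $\mathbb{F}_{q^{nt}}$ (whose restriction generates $\mathrm{Gal}(\mathbb{F}_{q^n}\colon\mathbb{F}_q)$). Let $a,b\in\mathbb{F}_{q^{nt}}$ with $a,b\ne0$ and \[ f(x)=-x+ax^{\sigma}+bx^{\sigma q^{\ell n}}. \] Then $\dim_{\mathbb{F}_q}\ker f\le t$. Moreover, if $t\le n\ell+s$ and at least one of the following conditions holds: 1. $s+h\ell\not\equiv0\pmod t$ for each $0\le h\le n$; 2. $j\ell\not\equiv0\pmod t$ for each $1\le j\le n$, and $s\not\equiv0\pmod t$; 3. $\ell n\not\equiv i\ell\pmod t$ for each $0\le i\le n-1$, and $s+\ell n\not\equiv0\pmod t$; then \[ \dim_{\mathbb{F}_q}\ker f\le\min\{t-1,(n-1)\ell+s\}. \]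
   Context: Notation: $x^{\sigma q^{\ell n}}:=x^{q^{s+\ell n}}$. $f$ is regarded as an $\mathbb{F}_q$-linear map $\mathbb{F}_{q^{nt}}\to\mathbb{F}_{q^{nt}}$; $\ker f$ is its set of roots in $\mathbb{F}_{q^{nt}}$. *)

theory Defs
  imports "HOL-Number_Theory.Number_Theory" "HOL-Library.Cardinality"
begin

text \<open>
  The type \<open>'k\<close> plays the role of F_q and \<open>'a\<close> that of its extension F_{q^{nt}}. The inclusion
  of the former into the latter is a ring homomorphism \<open>\<iota>\<close> (injective, as its domain is a field);
  its image is the unique subfield of order q, that is the set of x with x^q = x.
\<close>

definition field_embedding :: "('k::field \<Rightarrow> 'a::field) \<Rightarrow> bool" where
  "field_embedding \<iota> \<longleftrightarrow>
     \<iota> 1 = 1 \<and> (\<forall>x y. \<iota> (x + y) = \<iota> x + \<iota> y) \<and> (\<forall>x y. \<iota> (x * y) = \<iota> x * \<iota> y)"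

definition ext_scale :: "('k::field \<Rightarrow> 'a::field) \<Rightarrow> 'k \<Rightarrow> 'a \<Rightarrow> 'a" where
  "ext_scale \<iota> c x = \<iota> c * x"

lemma vector_space_ext_scale:
  assumes "field_embedding \<iota>"
  shows "vector_space (ext_scale \<iota>)"
  using assms by unfold_locales (auto simp: field_embedding_def ext_scale_def algebra_simps)

text \<open>
  With \<open>\<sigma> x = x ^ (q ^ s)\<close>, the expression x^{\<open>\<sigma>\<close> q^{ln}} denotes \<open>x ^ (q ^ (s + l * n))\<close>.
\<close>

definition sigma :: "nat \<Rightarrow> nat \<Rightarrow> 'a::field \<Rightarrow> 'a" where
  "sigma q s x = x ^ (q ^ s)"

definition trinomial ::
    "nat \<Rightarrow> nat \<Rightarrow> nat \<Rightarrow> nat \<Rightarrow> 'a::field \<Rightarrow> 'a \<Rightarrow> 'a \<Rightarrow> 'a" where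
  "trinomial q n s l a b x = - x + a * sigma q s x + b * sigma q (s + l * n) x"

definition ker :: "('a \<Rightarrow> 'a::zero) \<Rightarrow> 'a set" where
  "ker f = {x. f x = 0}"

end

theory Submission
  imports Defs "HOL-Computational_Algebra.Polynomial"
begin

text \<open>
  The kernel of \<open>f\<close> is the set of fixed points of \<open>T x = a x ^ q ^ s + b x ^ q ^ (s + l n)\<close>, which is
  semilinear over \<open>F_{q^n}\<close> with respect to the generator \<open>x \<mapsto> x ^ q ^ s\<close> of the Galois group.
  Hence fixed points independent over \<open>F_q\<close> are independent over \<open>F_{q^n}\<close>, which gives the bound \<open>t\<close>.
  The \<open>n\<close>-th iterate of \<open>T\<close> is \<open>F_{q^n}\<close>-linear and fixes the \<open>F_{q^n}\<close>-span of the kernel. It is a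
  \<open>q^n\<close>-polynomial with exponents \<open>q ^ (n (s + h l))\<close> for \<open>h \<le> n\<close>; if it differs from the identity,
  its reduction modulo \<open>x ^ q ^ (n t) - x\<close> minus \<open>x\<close> has \<open>q^n\<close>-degree at most
  \<open>min (t - 1) ((n - 1) l + s)\<close>, which bounds the size of that span.
\<close>

section \<open>Power maps and root counting in finite fields\<close>

lemma power_CARD_eq_same:
  fixes x :: "'a::{finite,field}"
  shows "x ^ CARD('a) = x"
proof (cases "x = 0")
  case False
  let ?U = "- {0 :: 'a}"
  have "bij_betw ((*) x) ?U ?U"
    by (rule bij_betwI[where g = "\<lambda>y. y / x"]) (use False in auto)
  then have "\<Prod>?U = (\<Prod>y\<in>?U. x * y)"
    by (simp add: prod.reindex_bij_betw[where g = "\<lambda>y. y"])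
  also have "\<dots> = x ^ card ?U * \<Prod>?U"
    by (simp add: prod.distrib)
  finally have "x ^ card ?U = 1"
    by simp
  moreover have "CARD('a) = Suc (card ?U)"
    by (simp add: Compl_eq_Diff_UNIV card_Suc_Diff1)
  ultimately show ?thesis
    by simp
qed (simp add: card_gt_0_iff)

lemma prime_CHAR_finite: "prime CHAR('a::{finite,field})"
  by (rule prime_CHAR_semidom, rule finite_imp_CHAR_pos) simp

lemma power_power_fixed:
  fixes x :: "'a::monoid_mult"
  assumes "x ^ (q ^ m) = x"
  shows "x ^ (q ^ (m * k)) = x"
  by (induction k) (simp_all add: assms power_add power_mult)

lemma power_power_mod:
  fixes x :: "'a::monoid_mult"
  assumes "x ^ (Q ^ t) = x"
  shows "x ^ (Q ^ k) = x ^ (Q ^ (k mod t))"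
proof -
  have "Q ^ k = Q ^ (t * (k div t)) * Q ^ (k mod t)"
    by (simp flip: power_add)
  then show ?thesis
    using power_power_fixed[OF assms, of "k div t"] by (simp only: power_mult)
qed

text \<open>By Bezout, \<open>s * u = n * v + 1\<close>: some multiple of \<open>s\<close> Frobenius
  steps, which fixes \<open>x\<close>, is a single step on top of \<open>n * v\<close> steps that
  also fix \<open>x\<close>.\<close>

lemma power_power_fixed_coprime:
  fixes x :: "'a::monoid_mult"
  assumes "x ^ (q ^ s) = x" "x ^ (q ^ n) = x" "s > 0" "gcd s n = 1"
  shows "x ^ q = x"
proof -
  obtain u v where uv: "s * u = n * v + 1"
    using bezout_nat[of s n] assms by auto
  have "x = x ^ (q ^ (n * v + 1))"
    using power_power_fixed[OF assms(1), of u] uv by simp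
  also have "\<dots> = (x ^ (q ^ (n * v))) ^ q"
    by (simp add: mult.commute flip: power_mult)
  also have "\<dots> = x ^ q"
    by (simp add: power_power_fixed[OF assms(2)])
  finally show ?thesis by simp
qed

text \<open>For \<open>Q > 1\<close> the exponents \<open>Q ^ i\<close> are distinct, so no
  coefficients merge and \<open>d r\<close> survives as a nonzero coefficient.\<close>

lemma card_roots_linearized_le:
  fixes d :: "nat \<Rightarrow> 'a::idom"
  assumes Q: "Q > 1" and r: "r \<le> m" "d r \<noteq> 0"
  shows "card {x. (\<Sum>i\<le>m. d i * x ^ (Q ^ i)) = 0} \<le> Q ^ m"
proof -
  define p where "p = (\<Sum>i\<le>m. monom (d i) (Q ^ i))"
  have "coeff p (Q ^ r) = (\<Sum>i\<le>m. if i = r then d i else 0)"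
    unfolding p_def coeff_sum using Q by (intro sum.cong) (auto simp: power_inject_exp)
  then have "p \<noteq> 0"
    using r by auto
  have "degree p \<le> Q ^ m"
    unfolding p_def using Q
    by (intro degree_sum_le) (auto intro!: order.trans[OF degree_monom_le] power_increasing)
  moreover have "poly p x = (\<Sum>i\<le>m. d i * x ^ (Q ^ i))" for x
    by (simp add: p_def poly_sum poly_monom)
  ultimately show ?thesis
    using card_poly_roots_bound[OF \<open>p \<noteq> 0\<close>] by simp
qed

text \<open>Since \<open>Q - 1\<close> divides \<open>Q ^ t - 1\<close>, the nonzero elements with \<open>x ^ Q \<noteq> x\<close> are roots of
  \<open>(x ^ (Q ^ t - 1) - 1) / (x ^ (Q - 1) - 1)\<close>, of degree \<open>Q ^ t - Q\<close>.\<close>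
lemma card_fixed_field_ge:
  assumes card: "CARD('a::{finite,field}) = Q ^ t" and "t > 0" "Q > 1"
  shows "card {x :: 'a. x ^ Q = x} \<ge> Q"
proof -
  let ?E = "{x :: 'a. x ^ Q = x}"
  have "(Q - 1) dvd (Q ^ t - 1)"
  proof -
    have "[Q = 1] (mod (Q - 1))"
      using \<open>Q > 1\<close> by (simp add: cong_def mod_if le_mod_geq)
    then have "[Q ^ t = 1 ^ t] (mod (Q - 1))"
      by (rule cong_pow)
    then show ?thesis
      using \<open>Q > 1\<close> by (simp add: cong_altdef_nat)
  qed
  then obtain c where c: "Q ^ t - 1 = (Q - 1) * c" ..
  have "Q ^ t > 1"
    using \<open>Q > 1\<close> \<open>t > 0\<close> by (rule one_less_power)
  then have "c > 0"
    using c by (cases c) auto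
  \<comment> \<open>The quotient as a geometric sum in \<open>x ^ (Q - 1)\<close>; its constant term
    1 shows that it is nonzero.\<close>
  define p :: "'a poly" where "p = (\<Sum>i<c. monom 1 ((Q - 1) * i))"
  have "coeff p 0 = (\<Sum>i<c. if i = 0 then 1 else 0)"
    unfolding p_def coeff_sum using \<open>Q > 1\<close> by (intro sum.cong) auto
  then have "p \<noteq> 0"
    using \<open>c > 0\<close> by auto
  have "degree p \<le> (Q - 1) * (c - 1)"
    unfolding p_def by (intro degree_sum_le) (auto intro!: order.trans[OF degree_monom_le])
  have "poly p x = 0" if "x \<notin> ?E" for x
  proof -
    have "x \<noteq> 0"
      using that \<open>Q > 1\<close> by auto
    have "x * x ^ (Q ^ t - 1) = x ^ (Q ^ t)"
      using power_minus_mult[of "Q ^ t" x] \<open>Q ^ t > 1\<close> by (simp only: mult.commute[of x])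
    also have "\<dots> = x"
      using power_CARD_eq_same[of x] by (simp only: card)
    finally have "x * x ^ (Q ^ t - 1) = x" .
    then have "x ^ (Q ^ t - 1) = 1"
      using \<open>x \<noteq> 0\<close> by simp
    then have 1: "(x ^ (Q - 1)) ^ c = 1"
      by (simp only: c power_mult)
    have 2: "x ^ (Q - 1) \<noteq> 1"
    proof
      assume "x ^ (Q - 1) = 1"
      then have "x * x ^ (Q - 1) = x" by simp
      then show False
        using that \<open>Q > 1\<close> by (simp flip: power_Suc)
    qed
    have "poly p x = (\<Sum>i<c. (x ^ (Q - 1)) ^ i)"
      by (simp add: p_def poly_sum poly_monom power_mult)
    also have "\<dots> = 0"
      using 1 2 by (simp add: geometric_sum)
    finally show ?thesis .
  qed
  then have "card (- ?E) \<le> card {x. poly p x = 0}"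
    by (intro card_mono) auto
  also have "\<dots> \<le> (Q - 1) * (c - 1)"
    using card_poly_roots_bound[OF \<open>p \<noteq> 0\<close>] \<open>degree p \<le> _\<close> by linarith
  also have "\<dots> = Q ^ t - Q"
    using c \<open>Q > 1\<close> by (simp add: diff_mult_distrib2)
  finally have "card (- ?E) \<le> Q ^ t - Q" .
  moreover have "card (- ?E) = Q ^ t - card ?E"
    by (simp add: Compl_eq_Diff_UNIV card_Diff_subset card)
  moreover have "Q \<le> Q ^ t"
    using \<open>Q > 1\<close> \<open>t > 0\<close> by (simp add: self_le_power)
  moreover have "card ?E \<le> Q ^ t"
    using card_mono[of UNIV ?E] by (simp add: card)
  ultimately show ?thesis by linarith
qed

section \<open>The base field inside the extension\<close>

lemma field_embedding_inj:
  assumes "field_embedding \<iota>"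
  shows "inj \<iota>"
proof (rule injI)
  have add: "\<iota> (x + y) = \<iota> x + \<iota> y" and mult: "\<iota> (x * y) = \<iota> x * \<iota> y" and one: "\<iota> 1 = 1" for x y
    using assms by (auto simp: field_embedding_def)
  fix x y assume "\<iota> x = \<iota> y"
  have "\<iota> (x - y) = 0"
    using add[of "x - y" y] \<open>\<iota> x = \<iota> y\<close> by simp
  show "x = y"
  proof (rule ccontr)
    assume "x \<noteq> y"
    then have "\<iota> ((x - y) * inverse (x - y)) = 1"
      using one by simp
    then show False
      using \<open>\<iota> (x - y) = 0\<close> by (simp add: mult)
  qed
qed

text \<open>The image already supplies as many roots of \<open>x ^ CARD('k) - x\<close> as the
  degree allows. The descent below recognises scalars from the base field this way.\<close>

lemma range_field_embedding:
  fixes \<iota> :: "'k::{finite,field} \<Rightarrow> 'a::{finite,field}"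
  assumes "field_embedding \<iota>"
  shows "range \<iota> = {x. x ^ CARD('k) = x}"
proof (rule card_seteq)
  have mult: "\<iota> (x * y) = \<iota> x * \<iota> y" and one: "\<iota> 1 = 1" for x y
    using assms by (auto simp: field_embedding_def)
  have pow: "\<iota> (x ^ k) = \<iota> x ^ k" for x k
    by (induction k) (simp_all add: one mult)
  show "range \<iota> \<subseteq> {x. x ^ CARD('k) = x}"
    by (auto simp: power_CARD_eq_same simp flip: pow)
  have "CARD('k) > 1"
    using card_mono[of UNIV "{0, 1 :: 'k}"] by simp
  let ?p = "monom 1 CARD('k) - monom 1 1 :: 'a poly"
  have "coeff ?p CARD('k) = 1"
    using \<open>CARD('k) > 1\<close> by simp
  then have "?p \<noteq> 0" by (metis coeff_0 zero_neq_one)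
  have "card {x :: 'a. x ^ CARD('k) = x} = card {x. poly ?p x = 0}"
    by (simp add: poly_monom)
  also have "\<dots> \<le> degree ?p"
    by (rule card_poly_roots_bound) fact
  also have "\<dots> \<le> CARD('k)"
    using \<open>CARD('k) > 1\<close>
    by (intro degree_diff_le) (auto intro!: order.trans[OF degree_monom_le])
  also have "\<dots> = card (range \<iota>)"
    using field_embedding_inj[OF assms] by (simp add: card_image)
  finally show "card {x :: 'a. x ^ CARD('k) = x} \<le> card (range \<iota>)" .
qed simp

section \<open>The semilinear map and the coefficients of its iterates\<close>

definition skew_binomial :: "nat \<Rightarrow> nat \<Rightarrow> nat \<Rightarrow> 'a::field \<Rightarrow> 'a \<Rightarrow> 'a \<Rightarrow> 'a" where
  "skew_binomial q s m a b x = a * x ^ (q ^ s) + b * x ^ (q ^ (s + m))"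

lemma ker_trinomial: "ker (trinomial q n s l a b) = {x. skew_binomial q s (l * n) a b x = x}"
  by (auto simp: ker_def trinomial_def skew_binomial_def sigma_def algebra_simps add_eq_0_iff)

text \<open>The coefficient of \<open>x ^ q ^ (s * k + h * m)\<close> in the \<open>k\<close>-th
  iterate. One more application twists it by \<open>q ^ s\<close> and keeps \<open>h\<close> (term
  \<open>a\<close>), or twists it by \<open>q ^ (s + m)\<close> and raises \<open>h\<close> by one
  (term \<open>b\<close>).\<close>

fun iterate_coeff :: "nat \<Rightarrow> nat \<Rightarrow> nat \<Rightarrow> 'a::field \<Rightarrow> 'a \<Rightarrow> nat \<Rightarrow> nat \<Rightarrow> 'a" where
  "iterate_coeff q s m a b 0 h = (if h = 0 then 1 else 0)"
| "iterate_coeff q s m a b (Suc k) h = a * iterate_coeff q s m a b k h ^ (q ^ s)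
     + (if h = 0 then 0 else b * iterate_coeff q s m a b k (h - 1) ^ (q ^ (s + m)))"

lemma iterate_coeff_eq_0: "q > 0 \<Longrightarrow> h > k \<Longrightarrow> iterate_coeff q s m a b k h = 0"
  by (induction k arbitrary: h) (auto simp: power_0_left)

lemma iterate_coeff_0_neq_0: "a \<noteq> 0 \<Longrightarrow> iterate_coeff q s m a b k 0 \<noteq> 0"
  by (induction k) auto

lemma iterate_coeff_diag_neq_0: "q > 0 \<Longrightarrow> b \<noteq> 0 \<Longrightarrow> iterate_coeff q s m a b k k \<noteq> 0"
  by (induction k) (auto simp: iterate_coeff_eq_0 power_0_left)

text \<open>In an extension of \<open>F_q\<close> of degree \<open>n t\<close>, the intermediate field \<open>F_{q^n}\<close> is the fixed field
  of \<open>x \<mapsto> x ^ q ^ n\<close>.\<close>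
locale finite_field_extension =
  fixes q n t :: nat and \<iota> :: "'k::{finite,field} \<Rightarrow> 'a::{finite,field}"
  assumes primepow_q: "primepow q"
    and n_pos: "n > 0" and t_pos: "t > 0"
    and card_base: "CARD('k) = q" and card_ext: "CARD('a) = q ^ (n * t)"
    and embedding: "field_embedding \<iota>"
begin

sublocale vs: vector_space "ext_scale \<iota>"
  by (rule vector_space_ext_scale) (rule embedding)

section \<open>Additivity of Frobenius powers and expansion of the iterates\<close>

lemma q_gt_1: "q > 1"
  using primepow_gt_Suc_0[OF primepow_q] by simp

lemma q_power_n_gt_1: "q ^ n > 1"
  using q_gt_1 n_pos by (rule one_less_power)

text \<open>The characteristic divides \<open>CARD('a)\<close>, a power of the prime underlying
  \<open>q\<close>, so it is that prime.\<close>

lemma q_power_CHAR: "\<exists>e. q = CHAR('a) ^ e"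
proof -
  obtain p k where pk: "prime p" "q = p ^ k"
    using primepow_q by (auto simp: primepow_def)
  have "CHAR('a) dvd p ^ (k * (n * t))"
    using CHAR_dvd_CARD[where 'a = 'a] by (simp add: card_ext pk power_mult)
  then have "CHAR('a) dvd p"
    using prime_CHAR_finite prime_dvd_power by blast
  then have "CHAR('a) = p"
    using primes_dvd_imp_eq[OF prime_CHAR_finite[where 'a = 'a] \<open>prime p\<close>] by simp
  then show ?thesis
    using pk by auto
qed

lemma frobenius_sum: "sum g A ^ (q ^ i) = (\<Sum>x\<in>A. (g x :: 'a) ^ (q ^ i))"
proof -
  obtain e where "q ^ i = CHAR('a) ^ e"
    using q_power_CHAR by (metis power_mult)
  then show ?thesis
    by (intro freshmans_dream_sum' prime_CHAR_finite)
qed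

lemma frobenius_diff: "(x - y :: 'a) ^ (q ^ i) = x ^ (q ^ i) - y ^ (q ^ i)"
proof -
  obtain e where "q ^ i = CHAR('a) ^ e"
    using q_power_CHAR by (metis power_mult)
  \<comment> \<open>Additivity applied to \<open>(x - y) + y\<close> avoids the sign
    \<open>(-1) ^ (q ^ i)\<close>.\<close>
  then have "(x - y) ^ (q ^ i) + y ^ (q ^ i) = x ^ (q ^ i)"
    using freshmans_dream'[OF prime_CHAR_finite, of "q ^ i" e "x - y" y] by simp
  then show ?thesis
    by (simp add: algebra_simps)
qed

lemma skew_binomial_sum:
  "skew_binomial q s m a b (sum g A) = (\<Sum>x\<in>A. skew_binomial q s m a b (g x :: 'a))"
  by (simp add: skew_binomial_def frobenius_sum sum.distrib sum_distrib_left)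

lemma iterate_skew_binomial:
  "(skew_binomial q s m a b ^^ k) x
     = (\<Sum>h\<le>k. iterate_coeff q s m a b k h * (x :: 'a) ^ (q ^ (s * k + h * m)))"
proof (induction k)
  case (Suc k)
  let ?c = "iterate_coeff q s m a b"
  let ?X = "\<lambda>h. x ^ (q ^ (s * Suc k + h * m))"
  have pow: "(x ^ (q ^ (s * k + h * m))) ^ (q ^ j) = x ^ (q ^ (s * k + h * m + j))" for h j
    by (simp only: power_add power_mult)
  have "(skew_binomial q s m a b ^^ Suc k) x
      = (\<Sum>h\<le>k. a * ?c k h ^ (q ^ s) * ?X h + b * ?c k h ^ (q ^ (s + m)) * ?X (Suc h))"
    by (simp add: Suc.IH skew_binomial_sum)
       (simp add: skew_binomial_def power_mult_distrib algebra_simps flip: power_mult power_add)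
  also have "\<dots> = (\<Sum>h\<le>k. a * ?c k h ^ (q ^ s) * ?X h)
      + (\<Sum>h\<le>k. b * ?c k h ^ (q ^ (s + m)) * ?X (Suc h))"
    by (simp add: sum.distrib)
  \<comment> \<open>Both sums are brought to the range up to \<open>Suc k\<close>: the first gains a
    zero coefficient at the top, the second is shifted and gains a zero term at
    \<open>h = 0\<close>.\<close>
  also have "(\<Sum>h\<le>k. a * ?c k h ^ (q ^ s) * ?X h) = (\<Sum>h\<le>Suc k. a * ?c k h ^ (q ^ s) * ?X h)"
    using q_gt_1 by (simp add: iterate_coeff_eq_0 power_0_left)
  also have "(\<Sum>h\<le>k. b * ?c k h ^ (q ^ (s + m)) * ?X (Suc h))
      = (\<Sum>h\<le>Suc k. (if h = 0 then 0 else b * ?c k (h - 1) ^ (q ^ (s + m))) * ?X h)"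
    by (subst sum.atMost_Suc_shift) simp
  also have "(\<Sum>h\<le>Suc k. a * ?c k h ^ (q ^ s) * ?X h) + \<dots> = (\<Sum>h\<le>Suc k. ?c (Suc k) h * ?X h)"
    unfolding sum.distrib[symmetric] by (intro sum.cong) (auto simp: algebra_simps)
  finally show ?case .
qed simp

section \<open>The intermediate field and Galois descent\<close>

abbreviation mid :: "'a set" where
  "mid \<equiv> {x. x ^ (q ^ n) = x}"

lemma card_mid_ge: "card mid \<ge> q ^ n"
  using card_fixed_field_ge[of "q ^ n" t, where 'a = 'a] q_power_n_gt_1 t_pos card_ext
  by (simp add: power_mult)

lemma mid_diff: "x \<in> mid \<Longrightarrow> y \<in> mid \<Longrightarrow> x - y \<in> mid"
  by (simp add: frobenius_diff)

lemma mid_divide: "x \<in> mid \<Longrightarrow> y \<in> mid \<Longrightarrow> x / y \<in> mid"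
  by (simp add: power_divide)

lemma mid_power: "x \<in> mid \<Longrightarrow> x ^ k \<in> mid"
  by (simp, metis mult.commute power_mult)

text \<open>Since \<open>n dvd m\<close>, raising to \<open>q ^ m\<close> fixes \<open>c\<close>, so
  both terms acquire the same twist of \<open>c\<close>.\<close>

lemma skew_binomial_mid:
  assumes "c \<in> mid" "n dvd m"
  shows "skew_binomial q s m a b (c * x) = c ^ (q ^ s) * skew_binomial q s m a b x"
proof -
  obtain k where k: "m = n * k" using assms(2) ..
  have "c ^ (q ^ (n * k)) = c"
    using assms(1) by (intro power_power_fixed) simp
  then have "c ^ (q ^ (s + m)) = c ^ (q ^ s)"
    by (simp add: k power_add power_mult mult.commute[of "q ^ s"])
  then show ?thesis
    by (simp add: skew_binomial_def power_mult_distrib algebra_simps)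
qed

lemma iterate_skew_binomial_mid:
  assumes "n dvd m"
  shows "c \<in> mid \<Longrightarrow> (skew_binomial q s m a b ^^ k) (c * x)
    = c ^ (q ^ (s * k)) * (skew_binomial q s m a b ^^ k) x"
proof (induction k)
  case (Suc k)
  have "c ^ (q ^ (s * k)) \<in> mid" using Suc.prems by (rule mid_power)
  then show ?case
    using Suc assms by (simp add: skew_binomial_mid power_add mult.commute flip: power_mult)
qed simp

text \<open>The usual argument for Galois descent: applying the semilinear map to a dependency with one
  coefficient equal to 1 and subtracting gives a shorter dependency, so all coefficients are
  invariant under \<open>x \<mapsto> x ^ q ^ s\<close>, hence in \<open>F_q\<close> because \<open>s\<close> and \<open>n\<close> are coprime.\<close>
lemma fixed_points_independent_over_mid:
  assumes s: "s > 0" "gcd s n = 1" and m: "n dvd m"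
    and B: "finite B" "\<not> vs.dependent B" "\<And>x. x \<in> B \<Longrightarrow> skew_binomial q s m a b x = x"
    and e: "\<And>x. x \<in> B \<Longrightarrow> e x \<in> mid" "(\<Sum>x\<in>B. e x * x) = 0"
  shows "\<forall>x\<in>B. e x = 0"
  using B e
proof (induction B arbitrary: e rule: finite_induct)
  case (insert y B)
  have indep: "\<not> vs.dependent B"
    using insert.prems(1) vs.dependent_mono by blast
  have sum0: "e y * y + (\<Sum>x\<in>B. e x * x) = 0"
    using insert by simp
  show ?case
  proof (cases "e y = 0")
    case True
    then have "\<forall>x\<in>B. e x = 0"
      using insert.prems sum0 indep by (intro insert.IH) auto
    with True show ?thesis by simp
  next
    case False
    define g where "g x = e x / e y" for x
    have g: "g x \<in> mid" if "x \<in> insert y B" for x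
      unfolding g_def using insert.prems(3) that by (intro mid_divide) auto
    have "g y = 1"
      using False by (simp add: g_def)
    have gsum: "(\<Sum>x\<in>insert y B. g x * x) = 0"
    proof -
      have "(\<Sum>x\<in>insert y B. g x * x) = (\<Sum>x\<in>insert y B. e x * x) / e y"
        by (simp add: g_def sum_divide_distrib)
      then show ?thesis
        using insert.prems by simp
    qed
    \<comment> \<open>The vectors are fixed points, so the map only twists the coefficients;
      subtracting the old relation then removes \<open>y\<close>, as \<open>g y = 1\<close>.\<close>
    have "(\<Sum>x\<in>insert y B. g x ^ (q ^ s) * x)
        = skew_binomial q s m a b (\<Sum>x\<in>insert y B. g x * x)"
      unfolding skew_binomial_sum
      using g m insert.prems(2) by (intro sum.cong) (simp_all add: skew_binomial_mid)
    also have "\<dots> = 0"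
      using q_gt_1 by (simp add: gsum skew_binomial_def power_0_left)
    finally have "(\<Sum>x\<in>insert y B. (g x ^ (q ^ s) - g x) * x) = 0"
      using gsum by (simp add: left_diff_distrib sum_subtractf)
    then have "(\<Sum>x\<in>B. (g x ^ (q ^ s) - g x) * x) = 0"
      using insert.hyps \<open>g y = 1\<close> by simp
    moreover have "g x ^ (q ^ s) - g x \<in> mid" if "x \<in> B" for x
      using that by (intro mid_diff mid_power g) auto
    ultimately have "\<forall>x\<in>B. g x ^ (q ^ s) - g x = 0"
      using insert.prems(2) indep by (intro insert.IH) auto
    then have "g x ^ (q ^ s) = g x" if "x \<in> insert y B" for x
      using that \<open>g y = 1\<close> by auto
    then have "g x ^ q = g x" if "x \<in> insert y B" for x
      using that g[OF that] s by (simp only: mem_Collect_eq power_power_fixed_coprime[of "g x" q s n])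
    then have "\<forall>x\<in>insert y B. g x \<in> range \<iota>"
      by (simp add: range_field_embedding[OF embedding] card_base)
    then have "\<forall>x\<in>insert y B. \<exists>u. g x = \<iota> u"
      by auto
    then obtain u where u: "\<And>x. x \<in> insert y B \<Longrightarrow> g x = \<iota> (u x)"
      by metis
    \<comment> \<open>The relation now has scalars in the base field, so independence forces
      \<open>u y = 0\<close>, against \<open>g y = 1\<close>.\<close>
    have "(\<Sum>x\<in>insert y B. ext_scale \<iota> (u x) x) = (\<Sum>x\<in>insert y B. g x * x)"
      by (intro sum.cong refl) (simp only: u ext_scale_def)
    also note gsum
    finally have "u y = 0"
      using vs.independentD[OF insert.prems(1), of "insert y B" u y] insert.hyps by simp
    moreover have "\<iota> 0 = 0"
      using embedding unfolding field_embedding_def by (metis add_cancel_right_right)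
    ultimately show ?thesis
      using u[of y] \<open>g y = 1\<close> by simp
  qed
qed simp

text \<open>The \<open>F_{q^n}\<close>-span of the fixed points consists of fixed points of the \<open>n\<close>-th iterate, which is
  \<open>F_{q^n}\<close>-linear.\<close>
lemma card_fixed_points_iterate:
  assumes s: "s > 0" "gcd s n = 1" and m: "n dvd m"
  shows "(q ^ n) ^ vs.dim {x. skew_binomial q s m a b x = x}
    \<le> card {x. (skew_binomial q s m a b ^^ n) x = x}"
proof -
  let ?T = "skew_binomial q s m a b"
  obtain B where B: "B \<subseteq> {x. ?T x = x}" "\<not> vs.dependent B" "card B = vs.dim {x. ?T x = x}"
    using vs.basis_exists[of "{x. ?T x = x}"] by metis
  define comb where "comb e = (\<Sum>x\<in>B. e x * x)" for e :: "'a \<Rightarrow> 'a"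
  \<comment> \<open>Distinct coefficient families give distinct sums, so the span has
    \<open>card mid ^ card B\<close> elements.\<close>
  have inj: "inj_on comb (B \<rightarrow>\<^sub>E mid)"
  proof (rule inj_onI)
    fix e e' assume e: "e \<in> B \<rightarrow>\<^sub>E mid" "e' \<in> B \<rightarrow>\<^sub>E mid" and eq: "comb e = comb e'"
    have "(\<Sum>x\<in>B. (e x - e' x) * x) = 0"
      using eq by (simp add: comb_def left_diff_distrib sum_subtractf)
    moreover have "e x - e' x \<in> mid" if "x \<in> B" for x
      using PiE_mem[OF e(1) that] PiE_mem[OF e(2) that] by (rule mid_diff)
    ultimately have "\<forall>x\<in>B. e x - e' x = 0"
      using B s m by (intro fixed_points_independent_over_mid[of s m B a b]) auto
    then show "e = e'"
      using e by (intro PiE_ext) auto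
  qed
  have fixed: "(?T ^^ n) (comb e) = comb e" if e: "e \<in> B \<rightarrow>\<^sub>E mid" for e
  proof -
    have iter_sum: "(?T ^^ k) (sum g B) = (\<Sum>x\<in>B. (?T ^^ k) (g x))" for g k
      by (induction k) (simp_all add: skew_binomial_sum)
    have iter_fix: "(?T ^^ k) x = x" if "x \<in> B" for x k
      by (induction k) (use that B in auto)
    have "(?T ^^ n) (e x * x) = e x * x" if "x \<in> B" for x
    proof -
      have "e x \<in> mid" using e that by auto
      \<comment> \<open>After \<open>n\<close> applications the accumulated twist is
        \<open>q ^ (s * n)\<close>, which is trivial on \<open>mid\<close>.\<close>
      then have "e x ^ (q ^ (n * s)) = e x"
        by (intro power_power_fixed) simp
      then show ?thesis
        using \<open>e x \<in> mid\<close> m that by (simp add: iterate_skew_binomial_mid iter_fix mult.commute[of s])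
    qed
    then show ?thesis
      by (simp add: comb_def iter_sum)
  qed
  have "(q ^ n) ^ card B \<le> card mid ^ card B"
    by (intro power_mono card_mid_ge) simp
  also have "\<dots> = card (comb ` (B \<rightarrow>\<^sub>E mid))"
    by (simp add: card_image[OF inj] card_funcsetE)
  also have "\<dots> \<le> card {x. (?T ^^ n) x = x}"
    using fixed by (intro card_mono) auto
  finally show ?thesis
    by (simp add: B(3))
qed

section \<open>The two dimension bounds\<close>

lemma dim_fixed_points_le:
  assumes "s > 0" "gcd s n = 1" "n dvd m"
  shows "vs.dim {x. skew_binomial q s m a b x = x} \<le> t"
proof -
  have "(q ^ n) ^ vs.dim {x. skew_binomial q s m a b x = x} \<le> CARD('a)"
    using card_fixed_points_iterate[OF assms, of a b] by (rule order.trans) (simp add: card_mono)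
  then show ?thesis
    using power_increasing_iff[OF q_power_n_gt_1] by (simp only: card_ext power_mult)
qed

text \<open>The exponent \<open>s * n + h * (l * n)\<close> is \<open>n * (s + h * l)\<close>, and
  \<open>x ^ (q ^ n) ^ t = x\<close>, so only \<open>s + h * l\<close> modulo \<open>t\<close>
  matters. Indices with the same residue merge, and their coefficients might cancel.\<close>

lemma iterate_skew_binomial_reduced:
  "(skew_binomial q s (l * n) a b ^^ n) x
     = (\<Sum>r<t. (\<Sum>h | h \<le> n \<and> (s + h * l) mod t = r. iterate_coeff q s (l * n) a b n h)
         * (x :: 'a) ^ ((q ^ n) ^ r))"
proof -
  let ?c = "iterate_coeff q s (l * n) a b n"
  have "x ^ ((q ^ n) ^ t) = x"
    using power_CARD_eq_same[of x] by (simp add: card_ext power_mult)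
  then have red: "x ^ (q ^ (s * n + h * (l * n))) = x ^ ((q ^ n) ^ ((s + h * l) mod t))" for h
    using power_power_mod[of x "q ^ n" t "s + h * l"]
    by (simp add: algebra_simps flip: power_mult)
  have "(skew_binomial q s (l * n) a b ^^ n) x
      = (\<Sum>h\<le>n. ?c h * x ^ ((q ^ n) ^ ((s + h * l) mod t)))"
    by (simp add: iterate_skew_binomial red)
  also have "\<dots> = (\<Sum>r<t. \<Sum>h | h \<in> {..n} \<and> (s + h * l) mod t = r.
      ?c h * x ^ ((q ^ n) ^ ((s + h * l) mod t)))"
    by (rule sum.group[symmetric]) (use t_pos in auto)
  also have "\<dots> = (\<Sum>r<t. (\<Sum>h | h \<le> n \<and> (s + h * l) mod t = r. ?c h) * x ^ ((q ^ n) ^ r))"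
    by (intro sum.cong) (auto simp: sum_distrib_right)
  finally show ?thesis .
qed

text \<open>Here \<open>d r\<close> is the coefficient of \<open>x ^ q ^ (n * r)\<close> in the \<open>n\<close>-th iterate minus the identity,
  reduced modulo \<open>x ^ q ^ (n * t) - x\<close>. Each of the three conditions isolates one nonzero
  coefficient: that of the identity, of the lowest, and of the highest term respectively.\<close>
lemma dim_fixed_points_le_min:
  fixes s l :: nat and a b :: 'a
  defines "d \<equiv> \<lambda>r. (\<Sum>h | h \<le> n \<and> (s + h * l) mod t = r. iterate_coeff q s (l * n) a b n h)
      - (if r = 0 then 1 else 0)"
  assumes s: "s > 0" "gcd s n = 1" and ab: "a \<noteq> 0" "b \<noteq> 0" and l: "l < t" "t \<le> n * l + s"
    and conditions: "(\<forall>h\<in>{0..n}. \<not> [s + h * l = 0] (mod t)) \<or>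
       ((\<forall>j\<in>{1..n}. \<not> [j * l = 0] (mod t)) \<and> \<not> [s = 0] (mod t)) \<or>
       ((\<forall>i\<in>{0..n - 1}. \<not> [l * n = i * l] (mod t)) \<and> \<not> [s + l * n = 0] (mod t))"
  shows "vs.dim {x. skew_binomial q s (l * n) a b x = x} \<le> min (t - 1) ((n - 1) * l + s)"
    (is "?dim \<le> ?m")
proof -
  let ?T = "skew_binomial q s (l * n) a b" and ?c = "iterate_coeff q s (l * n) a b n"
  have "\<exists>r. d r \<noteq> 0"
    using conditions
  proof (elim disjE conjE)
    assume *: "\<forall>h\<in>{0..n}. \<not> [s + h * l = 0] (mod t)"
    then have none: "{h. h \<le> n \<and> (s + h * l) mod t = 0} = {}"
      by (auto simp: cong_def)
    have "d 0 = - 1"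
      unfolding d_def none by simp
    then show ?thesis by (metis neg_equal_0_iff_equal zero_neq_one)
  next
    assume *: "\<forall>j\<in>{1..n}. \<not> [j * l = 0] (mod t)" and "\<not> [s = 0] (mod t)"
    have "h = 0" if "h \<le> n" "(s + h * l) mod t = s mod t" for h
    proof -
      have "[s + h * l = s + 0] (mod t)"
        using that by (simp add: cong_def)
      then have "[h * l = 0] (mod t)"
        by (simp only: cong_add_lcancel_nat)
      then show ?thesis
        using * that(1) by (metis One_nat_def Suc_leI atLeastAtMost_iff gr0I)
    qed
    then have "{h. h \<le> n \<and> (s + h * l) mod t = s mod t} = {0}"
      by auto
    \<comment> \<open>A nonzero residue keeps the coefficient of the identity out of this
      one.\<close>
    moreover have "s mod t \<noteq> 0"
      using \<open>\<not> [s = 0] (mod t)\<close> by (simp add: cong_def)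
    ultimately have "d (s mod t) = ?c 0"
      unfolding d_def by simp
    then show ?thesis
      using iterate_coeff_0_neq_0[OF ab(1)] by metis
  next
    assume *: "\<forall>i\<in>{0..n - 1}. \<not> [l * n = i * l] (mod t)" and "\<not> [s + l * n = 0] (mod t)"
    have "h = n" if "h \<le> n" "(s + h * l) mod t = (s + l * n) mod t" for h
    proof (rule ccontr)
      assume "h \<noteq> n"
      have "[s + l * n = s + h * l] (mod t)"
        using that by (simp add: cong_def)
      then have "[l * n = h * l] (mod t)"
        by (simp only: cong_add_lcancel_nat)
      moreover have "h \<in> {0..n - 1}"
        using \<open>h \<noteq> n\<close> that by auto
      ultimately show False
        using * by blast
    qed
    then have "{h. h \<le> n \<and> (s + h * l) mod t = (s + l * n) mod t} = {n}"
      by (auto simp: mult.commute)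
    moreover have "(s + l * n) mod t \<noteq> 0"
      using \<open>\<not> [s + l * n = 0] (mod t)\<close> by (simp add: cong_def)
    ultimately have "d ((s + l * n) mod t) = ?c n"
      unfolding d_def by simp
    then show ?thesis
      using iterate_coeff_diag_neq_0[OF _ ab(2)] q_gt_1 by (metis gr_zeroI not_less0)
  qed
  then obtain r where r: "d r \<noteq> 0" ..
  have top: "i \<le> ?m" if "d i \<noteq> 0" for i
  proof (cases "i = 0")
    case False
    then have "(\<Sum>h | h \<le> n \<and> (s + h * l) mod t = i. ?c h) \<noteq> 0"
      using that by (simp add: d_def)
    then have "{h. h \<le> n \<and> (s + h * l) mod t = i} \<noteq> {}"
      by (rule contrapos_nn) (simp only: sum.empty)
    then obtain h where h: "h \<le> n" "i = (s + h * l) mod t" by auto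
    have "i \<le> (n - 1) * l + s"
    proof (cases "h = n")
      case True
      \<comment> \<open>Only \<open>h = n\<close> can exceed the bound before reduction. As
        \<open>t \<le> n * l + s\<close>, at least one \<open>t\<close> can be subtracted, and
        \<open>l < t\<close> makes the result small enough.\<close>
      have "(s + n * l) mod t = (s + n * l - t) mod t"
        using l by (simp add: le_mod_geq)
      also have "\<dots> \<le> s + n * l - t"
        by simp
      also have "\<dots> \<le> (n - 1) * l + s"
        using l n_pos by (cases n) auto
      finally show ?thesis
        using h True by simp
    next
      case False
      then have "h * l \<le> (n - 1) * l"
        using h by (intro mult_right_mono) auto
      moreover have "i \<le> s + h * l"
        using h by simp
      ultimately show ?thesis by linarith
    qed
    moreover have "i < t"
      using h t_pos by simp
    ultimately show ?thesis by simp
  qed simp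
  have diff: "(?T ^^ n) x - x = (\<Sum>i\<le>?m. d i * x ^ ((q ^ n) ^ i))" for x
  proof -
    have "(\<Sum>i<t. (if i = 0 then 1 else 0) * x ^ ((q ^ n) ^ i)) = (\<Sum>i<t. if i = 0 then x else 0)"
      by (intro sum.cong) auto
    then have "(?T ^^ n) x - x = (\<Sum>i<t. d i * x ^ ((q ^ n) ^ i))"
      using t_pos
      by (simp add: iterate_skew_binomial_reduced d_def left_diff_distrib sum_subtractf)
    also have "\<dots> = (\<Sum>i\<le>?m. d i * x ^ ((q ^ n) ^ i))"
      \<comment> \<open>By \<open>top\<close>, the coefficients beyond the claimed degree
        vanish.\<close>
      using top t_pos by (intro sum.mono_neutral_right) auto
    finally show ?thesis .
  qed
  have "{x. (?T ^^ n) x = x} = {x. (\<Sum>i\<le>?m. d i * x ^ ((q ^ n) ^ i)) = 0}"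
    unfolding diff[symmetric] by simp
  then have "card {x. (?T ^^ n) x = x} \<le> (q ^ n) ^ ?m"
    using card_roots_linearized_le[of "q ^ n" r ?m d] top[OF r] r q_power_n_gt_1
    by simp
  then have "(q ^ n) ^ ?dim \<le> (q ^ n) ^ ?m"
    using card_fixed_points_iterate[OF s, of "l * n" a b] by simp
  then show ?thesis
    by (simp only: power_increasing_iff[OF q_power_n_gt_1])
qed

end

theorem theorem4p1:
  fixes q n t s l :: nat
    and \<iota> :: "'k::{finite,field} \<Rightarrow> 'a::{finite,field}"
    and a b :: 'a
  assumes "primepow q"
    and "n > 0" and "t > 0" and "s > 0"
    and "gcd s n = 1"
    and "1 \<le> l" and "l \<le> t - 1"
    and "CARD('k) = q" and "CARD('a) = q ^ (n * t)"
    and "field_embedding \<iota>"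
    and "a \<noteq> 0" and "b \<noteq> 0"
  shows "vector_space.dim (ext_scale \<iota>) (ker (trinomial q n s l a b)) \<le> t \<and>
    (t \<le> n * l + s \<and>
      ((\<forall>h\<in>{0..n}. \<not> [s + h * l = 0] (mod t)) \<or>
       ((\<forall>j\<in>{1..n}. \<not> [j * l = 0] (mod t)) \<and> \<not> [s = 0] (mod t)) \<or>
       ((\<forall>i\<in>{0..n - 1}. \<not> [l * n = i * l] (mod t)) \<and> \<not> [s + l * n = 0] (mod t)))
     \<longrightarrow> vector_space.dim (ext_scale \<iota>) (ker (trinomial q n s l a b))
           \<le> min (t - 1) ((n - 1) * l + s))"
proof -
  interpret finite_field_extension q n t \<iota>
    using assms by unfold_locales
  have "l < t"
    using assms by simp
  then show ?thesis
    unfolding ker_trinomial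
    using assms dim_fixed_points_le[of s "l * n" a b] dim_fixed_points_le_min[of s a b l]
    by (intro conjI impI) simp_all
qed

end
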